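(* Let $d$ be an odd positive integer and let $n=R(d)$ be the next odd number after $d$ in the Collatz sequence. Let $\mathrm{Flag}\in\{0,1\}$ and $\mathrm{Num}$ be the quantities computed from the binary representation of $d$ as described in the context. Then $$(\text{number of binary digits of } n)-(\text{number of binary digits of } d)=1+\mathrm{Flag}-\mathrm{Num}.$$
   Context: Reduced Collatz map: for an odd positive integer $d$, $R(d)$ is the odd positive integer obtained from $3d+1$ by dividing out all factors of $2$. Binary representations are written without leading zeros when counting digits. Method 1. Let the binary representation of $d$ have $L$ digits. Put one digit $0$ in front of the leading $1$, obtaining the string $b_L b_{L-1}\dots b_1 b_0$ of length $L+1$, where $b_0=1$ is the rightmost digit and $b_L=0$. - $\mathrm{Flag}$: start with Flag $=1$. For $i=1,2,\dots,L$ in this order, look at the pair of adjacent digits $b_i b_{i-1}$: if Flag $=0$ and the pair is $11$, set Flag $=1$; if Flag $=1$ and the pair is $00$, set Flag $=0$; otherwise leave Flag unchanged. $\mathrm{Flag}$ denotes the final value. - $\mathrm{Num}$: the number of contiguous alternating digits starting from the right end of the string $b_L\dots b_0$, i.e. the largest $m$ with $1\le m\le L+1$ such that $b_i\neq b_{i-1}$ for all $1\le i\le m-1$ (the rightmost digit $1$ always counts as $1$). *)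

theory Defs
  imports "HOL-Library.Log_Nat" "HOL-Computational_Algebra.Primes"
begin

text \<open>
  Throughout, \<open>floorlog 2 d\<close> is the number L of binary digits of a positive \<open>d\<close>, and the digit
  of weight \<open>2 ^ i\<close> is 1 iff \<open>bit d i\<close>. Since \<open>bit d L\<close> is false, the digits \<open>bit d L\<close>, ...,
  \<open>bit d 0\<close> are exactly the binary representation of \<open>d\<close> with one 0 put in front.
\<close>

definition reduced_collatz :: "nat \<Rightarrow> nat" where
  "reduced_collatz d = (3 * d + 1) div 2 ^ multiplicity 2 (3 * d + 1)"

text \<open>\<open>flag_upto d i\<close> is the value of the flag after the adjacent pairs up to the pair with digits
  i (left) and i - 1 (right) have been processed.\<close>

fun flag_upto :: "nat \<Rightarrow> nat \<Rightarrow> nat" where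
  "flag_upto d 0 = 1"
| "flag_upto d (Suc i) =
    (if flag_upto d i = 0 \<and> bit d (Suc i) \<and> bit d i then 1
     else if flag_upto d i = 1 \<and> \<not> bit d (Suc i) \<and> \<not> bit d i then 0
     else flag_upto d i)"

definition Flag :: "nat \<Rightarrow> nat" where
  "Flag d = flag_upto d (floorlog 2 d)"

definition Num :: "nat \<Rightarrow> nat" where
  "Num d = Max {m. 1 \<le> m \<and> m \<le> floorlog 2 d + 1 \<and>
                   (\<forall>i. 1 \<le> i \<and> i \<le> m - 1 \<longrightarrow> bit d i \<noteq> bit d (i - 1))}"

end

theory Submission
  imports Defs
begin

text \<open>
  Adding d, 2 d and 1 in binary, the carry out of position i is the flag after step i, because
  the carry is set by the digit pair 11, cleared by 00 and preserved by 01 and 10. If d has L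
  digits, the final flag is therefore the digit of weight 2 ^ (L + 1) of 3 d + 1, so 3 d + 1 has
  L + 1 + Flag digits. As long as the digits of d alternate, the incoming carry is 1 and the sum
  digit is 0, so Num is the number of trailing zeros of 3 d + 1.
\<close>

lemma mod_power_2_Suc:
  fixes d :: nat
  shows "d mod 2 ^ Suc i = d mod 2 ^ i + (if bit d i then 2 ^ i else 0)"
  using take_bit_Suc_from_most[of i d] by (simp add: take_bit_eq_mod)

text \<open>\<open>2 * (d mod 2 ^ i)\<close> is \<open>2 * d\<close> cut to its lowest
  \<open>i + 1\<close> digits, so the quotient is the carry out of position \<open>i\<close>.
  Oddness of \<open>d\<close> gives the base case: column 0 sums to 1 + 0 + 1, whose carry is the
  initial flag 1.\<close>

lemma flag_upto_eq_carry:
  assumes "odd d"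
  shows "flag_upto d i = (d mod 2 ^ Suc i + 2 * (d mod 2 ^ i) + 1) div 2 ^ Suc i"
proof (induction i)
  case 0
  then show ?case using assms by (simp add: odd_iff_mod_2_eq_one)
next
  case (Suc i)
  define y P where "y = d mod 2 ^ i" and "P = (2 ^ i :: nat)"
  define a b where "a = (if bit d i then 1 else 0 :: nat)"
    and "b = (if bit d (Suc i) then 1 else 0 :: nat)"
  define c where "c = (3 * y + a * P + 1) div (2 * P)"
  have P: "P > 0" and y: "y < P" by (simp_all add: y_def P_def)
  have m1: "d mod 2 ^ Suc i = y + a * P"
    unfolding mod_power_2_Suc y_def P_def a_def by simp
  have m2: "d mod 2 ^ Suc (Suc i) = y + a * P + b * (2 * P)"
    unfolding mod_power_2_Suc[of d "Suc i"] m1 by (simp add: P_def b_def)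
  have c: "flag_upto d i = c"
    unfolding Suc.IH m1 by (simp add: y_def [symmetric] P_def c_def algebra_simps)
  define r where "r = (3 * y + a * P + 1) mod (2 * P)"
  have sum: "3 * y + a * P + 1 = 2 * P * c + r" and r: "r < 2 * P"
    using P by (simp_all add: c_def r_def)
  have "a \<le> 1" by (simp add: a_def)
  then have "a * P \<le> P" by simp
  then have "3 * y + a * P + 1 < 2 * (2 * P)" using y by linarith
  then have c_less: "c < 2"
    unfolding c_def by (simp add: less_mult_imp_div_less)
  \<comment> \<open>Column \<open>i + 1\<close> has weight \<open>2 * P\<close> and receives
    \<open>b\<close> from \<open>d\<close>, \<open>a\<close> from \<open>2 * d\<close>, and the
    incoming carry \<open>c\<close>.\<close>
  have "d mod 2 ^ Suc (Suc i) + 2 * (d mod 2 ^ Suc i) + 1 = 2 * P * (a + b + c) + r"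
    unfolding m1 m2 using sum by (simp add: algebra_simps)
  then have "(d mod 2 ^ Suc (Suc i) + 2 * (d mod 2 ^ Suc i) + 1) div 2 ^ Suc (Suc i)
      = (2 * P * (a + b + c) + r) div (4 * P)"
    by (simp only:) (simp add: P_def)
  also have "\<dots> = (2 * P * (a + b + c) + r) div (2 * P) div 2"
    by (simp add: div_mult2_eq [symmetric] mult.commute)
  also have "\<dots> = (a + b + c) div 2"
    using r P by simp
  finally have *: "(d mod 2 ^ Suc (Suc i) + 2 * (d mod 2 ^ Suc i) + 1) div 2 ^ Suc (Suc i)
      = (a + b + c) div 2" .
  \<comment> \<open>\<open>(a + b + c) div 2\<close> is the majority of three binary digits: equal
    \<open>a\<close> and \<open>b\<close> decide it, otherwise \<open>c\<close> survives. This is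
    the flag rule.\<close>
  show ?case
    unfolding * flag_upto.simps c using c_less by (auto simp: a_def b_def less_2_cases_iff)
qed

text \<open>Induction on \<open>k\<close>. If \<open>2 ^ Suc k\<close> divides
  \<open>3 * d + 1\<close>, the parity of the cofactor depends only on the digits at
  \<open>k\<close> and \<open>Suc k\<close>; if it does not, no higher power divides either.\<close>

lemma power_2_dvd_iff_alternating:
  fixes d :: nat
  assumes "odd d"
  shows "2 ^ Suc k dvd 3 * d + 1 \<longleftrightarrow> (\<forall>i. 1 \<le> i \<and> i \<le> k \<longrightarrow> bit d i \<noteq> bit d (i - 1))"
proof (induction k)
  case 0
  then show ?case using assms by simp
next
  case (Suc k)
  have "2 ^ Suc (Suc k) dvd 3 * d + 1 \<longleftrightarrow> bit d (Suc k) \<noteq> bit d k"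
    if dvd: "2 ^ Suc k dvd 3 * d + 1"
  proof -
    define y P where "y = d mod 2 ^ k" and "P = (2 ^ k :: nat)"
    define a b where "a = (if bit d k then 1 else 0 :: nat)"
      and "b = (if bit d (Suc k) then 1 else 0 :: nat)"
    have P: "P > 0" and y: "y < P" by (simp_all add: y_def P_def)
    have m1: "d mod 2 ^ Suc k = y + a * P"
      unfolding mod_power_2_Suc y_def P_def a_def by simp
    have m2: "d mod 2 ^ Suc (Suc k) = y + a * P + b * (2 * P)"
      unfolding mod_power_2_Suc[of d "Suc k"] m1 by (simp add: P_def b_def)
    have reduce: "2 ^ j dvd 3 * d + 1 \<longleftrightarrow> 2 ^ j dvd 3 * (d mod 2 ^ j) + 1" for j
      unfolding dvd_eq_mod_eq_0
      by (subst mod_add_cong[OF mod_mult_cong[OF refl mod_mod_trivial[symmetric]] refl]) (rule refl)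
    obtain q where q: "3 * (y + a * P) + 1 = 2 * P * q"
      using dvd unfolding reduce m1 by (auto simp: P_def elim: dvdE)
    have q_eq: "q = Suc a"
    proof -
      \<comment> \<open>Since \<open>3 * y + 1 < 3 * P\<close> and \<open>a\<close> is 0 or 1, the
        value \<open>3 * (y + a * P) + 1\<close> lies strictly between these multiples of
        \<open>2 * P\<close>, which leaves one choice for \<open>q\<close>.\<close>
      have "2 * P * a < 2 * P * q" "2 * P * q < 2 * P * (a + 2)"
        unfolding q [symmetric] using y by (auto simp: a_def)
      then have "a < q" "q < a + 2"
        unfolding mult_less_cancel1 by simp_all
      then show ?thesis by simp
    qed
    have "3 * (d mod 2 ^ Suc (Suc k)) + 1 = 2 * P * (q + 3 * b)"
      unfolding m2 using q by (simp add: algebra_simps)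
    moreover have "2 ^ Suc (Suc k) = 2 * P * 2"
      by (simp add: P_def)
    ultimately have "2 ^ Suc (Suc k) dvd 3 * d + 1 \<longleftrightarrow> 2 * P * 2 dvd 2 * P * (q + 3 * b)"
      using reduce[of "Suc (Suc k)"] by (simp only:)
    also have "\<dots> \<longleftrightarrow> even (q + 3 * b)"
      unfolding nat_mult_dvd_cancel_disj using P by simp
    \<comment> \<open>\<open>Suc a + 3 * b\<close> is even exactly when \<open>a\<close> and
      \<open>b\<close> differ.\<close>
    finally show ?thesis by (auto simp: q_eq a_def b_def)
  qed
  moreover have "2 ^ Suc k dvd 3 * d + 1" if "2 ^ Suc (Suc k) dvd 3 * d + 1"
    using that by (rule power_le_dvd) simp
  moreover have "(\<forall>i. 1 \<le> i \<and> i \<le> Suc k \<longrightarrow> Q i) \<longleftrightarrow> (\<forall>i. 1 \<le> i \<and> i \<le> k \<longrightarrow> Q i) \<and> Q (Suc k)" for Q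
    by (auto simp: le_Suc_eq)
  note this[of "\<lambda>i. bit d i \<noteq> bit d (i - 1)", unfolded diff_Suc_1]
  ultimately show ?case
    using Suc.IH by blast
qed

lemma less_power_2_floorlog: "d < 2 ^ floorlog 2 d"
  using floorlog_leD[of 2 d] floorlog_bounds[of d 2] by (cases "d = 0") auto

lemma Num_eq_multiplicity:
  assumes "odd d"
  shows "Num d = multiplicity 2 (3 * d + 1)"
proof -
  let ?v = "multiplicity 2 (3 * d + 1)" and ?L = "floorlog 2 d"
  have dvd_iff: "2 ^ m dvd 3 * d + 1 \<longleftrightarrow> m \<le> ?v" for m
    by (rule power_dvd_iff_le_multiplicity) auto
  \<comment> \<open>This shows that the cap \<open>?L + 1\<close> in \<open>Num\<close> never cuts
    the alternating run short.\<close>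
  have "2 ^ ?v \<le> 3 * d + 1"
    by (rule dvd_imp_le[OF multiplicity_dvd]) simp
  also have "\<dots> < 2 ^ (?L + 2)"
    using less_power_2_floorlog[of d] by simp
  finally have v_le: "?v \<le> ?L + 1"
    using power_less_imp_less_exp[of "2::nat" ?v "?L + 2"] by simp
  \<comment> \<open>Makes \<open>{1..?v}\<close> nonempty, so that its \<open>Max\<close> is
    meaningful.\<close>
  have v_ge: "1 \<le> ?v"
    using assms dvd_iff[of 1] by simp
  have alternating_iff:
    "(\<forall>i. 1 \<le> i \<and> i \<le> m - 1 \<longrightarrow> bit d i \<noteq> bit d (i - 1)) \<longleftrightarrow> m \<le> ?v" if "1 \<le> m" for m
    using power_2_dvd_iff_alternating[OF assms, of "m - 1"] dvd_iff[of m] that by simp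
  have "{m. 1 \<le> m \<and> m \<le> ?L + 1 \<and> (\<forall>i. 1 \<le> i \<and> i \<le> m - 1 \<longrightarrow> bit d i \<noteq> bit d (i - 1))}
      = {m. 1 \<le> m \<and> m \<le> ?L + 1 \<and> m \<le> ?v}"
    by (intro Collect_cong conj_cong refl alternating_iff)
  also have "\<dots> = {1..?v}"
    using v_le by auto
  finally have "Num d = Max {1..?v}"
    unfolding Num_def by (rule arg_cong)
  also have "\<dots> = ?v"
    by (rule Max_eqI) (use v_ge in simp_all)
  finally show ?thesis .
qed

lemma floorlog_eq_Flag:
  assumes "odd d"
  shows "floorlog 2 (3 * d + 1) = floorlog 2 d + 1 + Flag d"
proof -
  let ?L = "floorlog 2 d"
  have L: "0 < d" "0 < ?L" using assms by (auto simp: floorlog_eq_zero_iff intro: Nat.gr0I)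
  have upper: "d < 2 ^ ?L" by (rule less_power_2_floorlog)
  have lower: "2 ^ (?L - 1) \<le> d" using floorlog_bounds[of d 2] L by simp
  have pow: "(2::nat) ^ ?L = 2 * 2 ^ (?L - 1)" using L by (simp flip: power_Suc)
  \<comment> \<open>At position \<open>?L\<close> neither truncation changes \<open>d\<close>, so
    the carry is a quotient of \<open>3 * d + 1\<close> itself.\<close>
  have Flag: "Flag d = (3 * d + 1) div 2 ^ Suc ?L"
    using upper by (simp add: Flag_def flag_upto_eq_carry[OF assms])
  have "(3 * d + 1) div 2 ^ Suc ?L < 2"
    by (rule less_mult_imp_div_less) (use upper in simp)
  then consider "Flag d = 0" "3 * d + 1 < 2 ^ Suc ?L" | "Flag d = 1" "2 ^ Suc ?L \<le> 3 * d + 1"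
    unfolding Flag by (cases "3 * d + 1 < 2 ^ Suc ?L") (auto simp: div_eq_0_iff less_2_cases_iff)
  then show ?thesis
  proof cases
    case 1
    \<comment> \<open>Flag 0 needs the lower bound \<open>2 ^ ?L \<le> 3 * d + 1\<close>, from the
      leading digit of \<open>d\<close>; flag 1 needs the upper bound
      \<open>3 * d + 1 < 2 ^ (?L + 2)\<close>.\<close>
    then show ?thesis using lower pow
      by (intro antisym floorlog_leI floorlog_geI) auto
  next
    case 2
    then show ?thesis using upper
      by (intro antisym floorlog_leI floorlog_geI) auto
  qed
qed

theorem mainTheorem2:
  fixes d n :: nat
  assumes "odd d" and "n = reduced_collatz d"
  shows "int (floorlog 2 n) - int (floorlog 2 d) = 1 + int (Flag d) - int (Num d)"
proof -
  let ?v = "multiplicity 2 (3 * d + 1)"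
  have n: "n * 2 ^ ?v = 3 * d + 1"
    unfolding assms(2) reduced_collatz_def by (simp add: multiplicity_dvd)
  then have "n \<noteq> 0" by (intro notI) simp
  \<comment> \<open>Multiplying a nonzero \<open>n\<close> by \<open>2 ^ ?v\<close> appends
    \<open>?v\<close> zero digits; for \<open>n = 0\<close> this would fail, as
    \<open>floorlog 2 0 = 0\<close>.\<close>
  then have "floorlog 2 (3 * d + 1) = floorlog 2 n + ?v"
    using floorlog_power[of n 2 ?v] unfolding n by simp
  then show ?thesis
    using floorlog_eq_Flag[OF assms(1)] Num_eq_multiplicity[OF assms(1)] by simp
qed

end
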